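(* Assume independent noise and let $(x_k,x_k^* )$ be generated by the adaptive Bregman-Kaczmarz method (both described in the context). Denote $\gamma=\theta(\hat x)/\|\mathbf{A}\|_{\square}^2$, where $\theta(\hat x)$ is the error bound constant described in the context, and let the stepsizes $\eta_k$ be chosen recursively by $$\beta_0=\frac{\|\mathbf{A}\|_{\square}^{2}\,D_{f}^{x_0^{*}}(x_0,\hat{x})}{\sigma^{2}},\qquad \eta_k=\frac{\gamma\beta_k}{\gamma\beta_k+1},\qquad \beta_{k+1}=\Big(1-\frac{\eta_k(2-\eta_k)}{2}\gamma\Big)\beta_k+\frac{\eta_k^2}{2}=\beta_k\Big(1-\frac{\gamma\eta_k}{2}\Big).$$ Then $$\mathbb{E}\big[\|x_{k}-\hat{x}\|_2^{2}\big] \leq 2\,\frac{\sigma^2}{\|\mathbf{A}\|_{\square}^{2}}\,\beta_{k},$$ where the expectation is over all randomness involved (all randomly chosen indices and all noise realizations).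
   Context: Problem. $\mathbf{A}\in\mathbb{R}^{m\times n}$ is partitioned into $M$ blocks of consecutive rows $\mathbf{A}_{(i)}\in\mathbb{R}^{m_i\times n}$, $i=1,\dots,M$; $b\in\mathbb{R}^m$ is partitioned accordingly into $b_{(i)}\in\mathbb{R}^{m_i}$. The system $\mathbf{A}x=b$ is consistent. The function $f:\mathbb{R}^n\to\mathbb{R}$ is (finite everywhere and) $1$-strongly convex, i.e. $f(y)\ge f(x)+\langle x^*,y-x\rangle+\tfrac12\|y-x\|_2^2$ for all $x,y\in\mathbb{R}^n$ and $x^*\in\partial f(x)$. $\hat x$ is the unique minimizer of $f$ subject to $\mathbf{A}x=b$. $f^*$ denotes the convex conjugate of $f$; it is differentiable with $1$-Lipschitz gradient. For a matrix, $\|\cdot\|_2$ is the spectral norm, and $\|\mathbf{A}\|_{\square}=\big(\sum_{i=1}^M\|\mathbf{A}_{(i)}\|_2^2\big)^{1/2}$. $\mathcal{R}(\mathbf{A}^\top)$ is the range of $\mathbf{A}^\top$. Bregman distance. For $x,y\in\mathbb{R}^n$ and $x^*\in\partial f(x)$, $D_f^{x^*}(x,y)=f(y)-f(x)-\langle x^*,y-x\rangle$. Error bound constant. Assume that: (i) $\partial f$ grows at most linearly: there are $\rho_1,\rho_2\ge0$ with $\|x^*\|_2\le\rho_1\|x\|_2+\rho_2$ for all $x\in\mathbb{R}^n$, $x^*\in\partial f(x)$; (ii) $\partial f$ is calm at $\hat x$: there are $\epsilon,\ell>0$ with $\partial f(x)\subset\partial f(\hat x)+\ell\|x-\hat x\|_2B_2$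 whenever $\|x-\hat x\|_2\le\epsilon$, where $B_2$ is the closed Euclidean unit ball; (iii) $\{\partial f(\hat x),\mathcal{R}(\mathbf{A}^\top)\}$ is linearly regular: there is $\zeta>0$ with $\operatorname{dist}(x^*,\partial f(\hat x)\cap\mathcal{R}(\mathbf{A}^\top))\le\zeta\big(\operatorname{dist}(x^*,\partial f(\hat x))+\operatorname{dist}(x^*,\mathcal{R}(\mathbf{A}^\top))\big)$ for all $x^*\in\mathbb{R}^n$. By a known theorem, under (i)-(iii) there is a constant $\theta(\hat x)>0$ such that $$D_f^{x^*}(x,\hat x)\le\frac1{\theta(\hat x)}\|\mathbf{A}x-b\|_2^2\quad\text{for all }x\in\mathbb{R}^n,\ x^*\in\partial f(x)\cap\mathcal{R}(\mathbf{A}^\top);$$ $\theta(\hat x)$ denotes this constant. Adaptive Bregman-Kaczmarz method. Choose $x_0^*\in\mathbb{R}^n$, set $x_0=\nabla f^*(x_0^* )$, and choose stepsizes $\eta_k$. In iteration $k=0,1,2,\dots$: choose a block index $i=i_k\in\{1,\dots,M\}$ at random with probability $p_i=\|\mathbf{A}_{(i)}\|_2^2/\|\mathbf{A}\|_{\square}^2$; obtain a perturbed block $\tilde b_{(i)}=b_{(i)}+\varepsilon_{(i)}$; and set $$x_{k+1}^*=x_k^*-\eta_k\frac{\mathbf{A}_{(i)}^\top(\mathbf{A}_{(i)}x_k-\tilde b_{(i)})}{\|\mathbf{A}_{(i)}\|_2^2},\qquad x_{k+1}=\nabla f^*(x_{k+1}^* ).$$ Independent noise. Each time a block is queried, the noise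 $\varepsilon_{(i)}\in\mathbb{R}^{m_i}$ is drawn anew, independently of all previous randomness in the method and of the choice of the index, with $\mathbb{E}[\varepsilon_{(i)}]=0$ and $\mathbb{E}[\|\varepsilon_{(i)}\|^2]=\sigma_i^2$. The total noise level is $\sigma=\big(\sum_{i=1}^M\sigma_i^2\big)^{1/2}$.
   Formalization: The initial dual point x_0^* is required to lie in the range of A^T rather than being arbitrary in R^n; otherwise the bound fails, e.g. f=‖x‖²/2 on R², A=(1 0), b=0, x_0^*=(0,1), θ=1, k=1. *)

theory Defs
  imports "HOL-Probability.Probability"
begin

section \<open>Convex analysis\<close>

definition subdifferential :: "('a::real_inner \<Rightarrow> real) \<Rightarrow> 'a \<Rightarrow> 'a set" where
  "subdifferential f x = {s. \<forall>y. f y \<ge> f x + s \<bullet> (y - x)}"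

(* The subgradient inequality alone would hold vacuously for a function without
   subgradients, so convexity is required explicitly. *)
definition strongly_convex1 :: "('a::real_inner \<Rightarrow> real) \<Rightarrow> bool" where
  "strongly_convex1 f \<longleftrightarrow> convex_on UNIV f \<and>
     (\<forall>x y. \<forall>s \<in> subdifferential f x.
        f y \<ge> f x + s \<bullet> (y - x) + (1/2) * (norm (y - x))\<^sup>2)"

(* Real-valued supremum: it is the genuine conjugate whenever that is finite, which is
   the case at every point if f is strongly convex. *)
definition convex_conjugate :: "('a::real_inner \<Rightarrow> real) \<Rightarrow> 'a \<Rightarrow> real" where
  "convex_conjugate f s = (SUP x. s \<bullet> x - f x)"

definition gradient :: "('a::real_inner \<Rightarrow> real) \<Rightarrow> 'a \<Rightarrow> 'a" where
  "gradient g x = (THE D. GDERIV g x :> D)"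

definition bregman_dist :: "('a::real_inner \<Rightarrow> real) \<Rightarrow> 'a \<Rightarrow> 'a \<Rightarrow> 'a \<Rightarrow> real" where
  "bregman_dist f s x y = f y - f x - s \<bullet> (y - x)"

definition subdiff_linear_growth :: "('a::real_inner \<Rightarrow> real) \<Rightarrow> bool" where
  "subdiff_linear_growth f \<longleftrightarrow> (\<exists>\<rho>1 \<ge> 0. \<exists>\<rho>2 \<ge> 0. \<forall>x. \<forall>s \<in> subdifferential f x.
     norm s \<le> \<rho>1 * norm x + \<rho>2)"

definition subdiff_calm_at :: "('a::real_inner \<Rightarrow> real) \<Rightarrow> 'a \<Rightarrow> bool" where
  "subdiff_calm_at f z \<longleftrightarrow> (\<exists>\<epsilon> > 0. \<exists>l > 0. \<forall>x. norm (x - z) \<le> \<epsilon> \<longrightarrow>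
     subdifferential f x \<subseteq>
       {t + (l * norm (x - z)) *\<^sub>R u | t u. t \<in> subdifferential f z \<and> u \<in> cball 0 1})"

(* The library has infdist x {} = 0 where the mathematics has dist(x, {}) = infinity, hence the
   explicit nonemptiness condition. *)
definition linearly_regular :: "'a::metric_space set \<Rightarrow> 'a set \<Rightarrow> bool" where
  "linearly_regular C D \<longleftrightarrow> C \<inter> D \<noteq> {} \<and>
     (\<exists>\<zeta> > 0. \<forall>s. infdist s (C \<inter> D) \<le> \<zeta> * (infdist s C + infdist s D))"

section \<open>Row blocks of a linear system\<close>

(* The rows of A are indexed by a finite linear order 'm, and blk r in {1..M} is the block
   containing row r; for monotone blk the blocks consist of consecutive rows. *)
definition consecutive_blocks :: "('m::{finite,linorder} \<Rightarrow> nat) \<Rightarrow> nat \<Rightarrow> bool" where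
  "consecutive_blocks blk M \<longleftrightarrow> mono blk \<and> range blk = {1..M}"

(* Blocks have different heights, so the i-th block is embedded into the full row space by
   zero padding. This changes neither its spectral norm nor Euclidean norms of block vectors,
   nor products of the form A_i^T (A_i x - b_i). *)
definition block_mat ::
    "('m::finite \<Rightarrow> nat) \<Rightarrow> nat \<Rightarrow> real^'n^'m \<Rightarrow> real^'n^'m" where
  "block_mat blk i A = (\<chi> r. if blk r = i then A $ r else 0)"

definition block_vec :: "('m::finite \<Rightarrow> nat) \<Rightarrow> nat \<Rightarrow> real^'m \<Rightarrow> real^'m" where
  "block_vec blk i v = (\<chi> r. if blk r = i then v $ r else 0)"

definition spectral_norm :: "real^'n^'m \<Rightarrow> real" where
  "spectral_norm B = onorm (\<lambda>v. B *v v)"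

definition square_norm :: "('m::finite \<Rightarrow> nat) \<Rightarrow> nat \<Rightarrow> real^'n^'m \<Rightarrow> real" where
  "square_norm blk M A = sqrt (\<Sum>i = 1..M. (spectral_norm (block_mat blk i A))\<^sup>2)"

definition range_transpose :: "real^'n^'m \<Rightarrow> (real^'n) set" where
  "range_transpose A = range (\<lambda>v. transpose A *v v)"

definition error_bound_constant ::
    "(real^'n \<Rightarrow> real) \<Rightarrow> real^'n^'m \<Rightarrow> real^'m \<Rightarrow> real^'n \<Rightarrow> real \<Rightarrow> bool" where
  "error_bound_constant f A b xh \<theta> \<longleftrightarrow> \<theta> > 0 \<and>
     (\<forall>x. \<forall>s \<in> subdifferential f x \<inter> range_transpose A.
        bregman_dist f s x xh \<le> (1 / \<theta>) * (norm (A *v x - b))\<^sup>2)"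

section \<open>The randomized method\<close>

(* Randomness of the method: \<iota> k is the block index of iteration k. The vector e k stacks, for
   every block i, the noise that is added to that block if it is queried in iteration k; only
   the part block_vec blk (\<iota> k) (e k) is used. The two independence conditions
   say that \<iota> 0, e 0, \<iota> 1, e 1, ... are mutually independent. Nothing is assumed about the
   joint law of the noises of different blocks in the same iteration. *)
definition random_blocks_indep_noise ::
    "'w measure \<Rightarrow> ('m::finite \<Rightarrow> nat) \<Rightarrow> nat \<Rightarrow> real^'n^'m \<Rightarrow> (nat \<Rightarrow> real) \<Rightarrow>
     (nat \<Rightarrow> 'w \<Rightarrow> nat) \<Rightarrow> (nat \<Rightarrow> 'w \<Rightarrow> real^'m) \<Rightarrow> bool" where
  "random_blocks_indep_noise P blk M A \<sigma> \<iota> e \<longleftrightarrow>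
     prob_space.indep_vars P (\<lambda>_. count_space UNIV \<Otimes>\<^sub>M borel) (\<lambda>k \<omega>. (\<iota> k \<omega>, e k \<omega>)) UNIV \<and>
     (\<forall>k. prob_space.indep_set P (sets (vimage_algebra (space P) (\<iota> k) (count_space UNIV)))
        (sets (vimage_algebra (space P) (e k) borel))) \<and>
     (\<forall>k. \<forall>\<omega> \<in> space P. \<iota> k \<omega> \<in> {1..M}) \<and>
     (\<forall>k. \<forall>i \<in> {1..M}. measure P {\<omega> \<in> space P. \<iota> k \<omega> = i} =
        (spectral_norm (block_mat blk i A))\<^sup>2 / (square_norm blk M A)\<^sup>2) \<and>
     (\<forall>k. \<forall>i \<in> {1..M}.
        integrable P (\<lambda>\<omega>. block_vec blk i (e k \<omega>)) \<and>
        prob_space.expectation P (\<lambda>\<omega>. block_vec blk i (e k \<omega>)) = 0 \<and>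
        integrable P (\<lambda>\<omega>. (norm (block_vec blk i (e k \<omega>)))\<^sup>2) \<and>
        prob_space.expectation P (\<lambda>\<omega>. (norm (block_vec blk i (e k \<omega>)))\<^sup>2) = (\<sigma> i)\<^sup>2)"

definition bregman_kaczmarz_step ::
    "('m::finite \<Rightarrow> nat) \<Rightarrow> real^'n^'m \<Rightarrow> nat \<Rightarrow> real \<Rightarrow> real^'m \<Rightarrow>
     real^'n \<Rightarrow> real^'n \<Rightarrow> real^'n" where
  "bregman_kaczmarz_step blk A i \<eta> bt x xs =
     xs - (\<eta> / (spectral_norm (block_mat blk i A))\<^sup>2) *\<^sub>R
       (transpose (block_mat blk i A) *v (block_mat blk i A *v x - bt))"

end

theory Submission
  imports Defs
begin

text \<open>The quantity that contracts is the Bregman distance from the iterate to the solution, not the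
  squared Euclidean distance. Viewed as a function of the dual iterate it is the convex
  conjugate of \<open>f\<close> plus an affine function (\<open>dual_bregman_eq\<close>). Strong convexity of \<open>f\<close> makes the
  conjugate differentiable with a quadratic upper bound (\<open>convex_conjugate_smooth\<close>), so a
  Kaczmarz step, which is a gradient step on the dual variable, changes the distance by at most an
  explicit quadratic expression in the residual and the noise of the queried block
  (\<open>dual_bregman_kaczmarz_step\<close>).

  Now take expectations. The current iterate is a function of the past indices and noises, so it
  is independent of the present ones (\<open>indep_var_driven_process\<close>), and the terms that are linear in
  the noise disappear (\<open>expectation_quadratic_on_event\<close>). The query probabilities turn the blockwise
  residuals into the residual of the whole system, to which the error bound applies: the dual
  iterates stay in the range of the transpose when they start there. The result
  (\<open>expected_dual_bregman_step\<close>) is a contraction of the expected distance by the factor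
  \<open>1 - \<eta> (2 - \<eta>) \<gamma> / 2\<close> plus a noise term proportional to \<open>\<eta>\<^sup>2\<close>.

  Measured in units of \<open>\<sigma>\<^sup>2\<close> over the squared norm of the matrix, this is exactly the recursion that
  defines \<open>\<beta>\<close>, so induction bounds the expected Bregman distance by \<open>\<beta>\<close>. The induction needs
  nonnegative contraction factors, hence \<open>\<gamma> \<le> 2\<close> unless \<open>\<beta>\<close> vanishes
  (\<open>error_bound_constant_le\<close>, \<open>stepsize_recursion_bounds\<close>). Strong convexity finally bounds
  half the squared Euclidean distance by the Bregman distance.\<close>

section \<open>The conjugate of a strongly convex function\<close>

lemma strongly_convex1D:
  assumes "strongly_convex1 f" "s \<in> subdifferential f x"
  shows "f x + s \<bullet> (y - x) + (1/2) * (norm (y - x))\<^sup>2 \<le> f y"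
  using assms unfolding strongly_convex1_def by auto

text \<open>Strong convexity beats every linear function, so \<^term>\<open>\<lambda>y. f y - s \<bullet> y\<close> attains its minimum,
  and its minimizers are exactly the points at which \<open>s\<close> is a subgradient. The one subgradient that is
  assumed provides the quadratic lower bound.\<close>

lemma strongly_convex1_ex_subgradient_at:
  fixes f :: "'a::euclidean_space \<Rightarrow> real"
  assumes f: "strongly_convex1 f" and t: "t \<in> subdifferential f z"
  shows "\<exists>x. s \<in> subdifferential f x"
proof -
  define h where "h y = f y - s \<bullet> y" for y
  define R where "R = 2 * norm (s - t)"
  have "continuous_on UNIV f"
    using f convex_on_continuous[of UNIV f] by (auto simp: strongly_convex1_def)
  then have "continuous_on (cball z R) h"
    unfolding h_def by (intro continuous_intros) (auto intro: continuous_on_subset)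
  moreover have "z \<in> cball z R" by (simp add: R_def)
  ultimately obtain x where x: "x \<in> cball z R" "\<And>y. y \<in> cball z R \<Longrightarrow> h x \<le> h y"
    using continuous_attains_inf[of "cball z R" h] by auto
  have "h x \<le> h y" for y
  proof (cases "y \<in> cball z R")
    case False
    then have far: "2 * norm (s - t) \<le> norm (y - z)"
      by (simp add: R_def dist_norm norm_minus_commute)
    have "(s - t) \<bullet> (y - z) \<le> norm (s - t) * norm (y - z)"
      by (rule norm_cauchy_schwarz)
    also have "\<dots> \<le> (1/2) * (norm (y - z))\<^sup>2"
      using mult_right_mono[OF far norm_ge_zero[of "y - z"]] by (simp add: power2_eq_square)
    finally have "h z \<le> h y"
      using strongly_convex1D[OF f t, of y] by (simp add: h_def inner_diff_left inner_diff_right)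
    with x(2)[OF \<open>z \<in> cball z R\<close>] show ?thesis by simp
  qed (use x(2) in auto)
  then have "s \<in> subdifferential f x"
    by (auto simp: subdifferential_def h_def inner_diff_right algebra_simps)
  then show ?thesis ..
qed

text \<open>That \<open>s\<close> is a subgradient at \<open>x\<close> means that \<open>x\<close> attains the supremum in the conjugate.\<close>

lemma convex_conjugate_eq:
  assumes "s \<in> subdifferential f x"
  shows "convex_conjugate f s = s \<bullet> x - f x"
  unfolding convex_conjugate_def
  by (rule cSup_eq_maximum)
    (use assms in \<open>auto simp: subdifferential_def inner_diff_right algebra_simps\<close>)

lemma convex_conjugate_lower:
  assumes "s \<in> subdifferential f x" "t \<in> subdifferential f y"
  shows "convex_conjugate f s + (t - s) \<bullet> x \<le> convex_conjugate f t"
proof -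
  have "f y + t \<bullet> (x - y) \<le> f x" using assms(2) by (auto simp: subdifferential_def)
  then show ?thesis
    by (simp add: convex_conjugate_eq[OF assms(1)] convex_conjugate_eq[OF assms(2)]
        inner_diff_left inner_diff_right)
qed

text \<open>The quadratic term of strong convexity at \<open>x\<close> absorbs the coupling
  \<^term>\<open>(t - s) \<bullet> (y - x)\<close> by Young's inequality: \<open>1\<close>-strong convexity of a function is
  \<open>1\<close>-smoothness of its conjugate.\<close>

lemma convex_conjugate_upper:
  assumes f: "strongly_convex1 f" and s: "s \<in> subdifferential f x" and t: "t \<in> subdifferential f y"
  shows "convex_conjugate f t \<le> convex_conjugate f s + (t - s) \<bullet> x + (1/2) * (norm (t - s))\<^sup>2"
proof -
  have "0 \<le> (norm ((t - s) - (y - x)))\<^sup>2" by simp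
  also have "\<dots> = (norm (t - s))\<^sup>2 - 2 * ((t - s) \<bullet> (y - x)) + (norm (y - x))\<^sup>2"
    by (simp add: power2_norm_eq_inner algebra_simps inner_commute)
  finally show ?thesis
    using strongly_convex1D[OF f s, of y]
    by (simp add: convex_conjugate_eq[OF s] convex_conjugate_eq[OF t]
        inner_diff_left inner_diff_right)
qed

lemma GDERIV_unique:
  assumes "GDERIV g x :> D" "GDERIV g x :> D'"
  shows "D = D'"
proof -
  have "(\<lambda>h. h \<bullet> D) = (\<lambda>h. h \<bullet> D')"
    using assms has_derivative_unique unfolding gderiv_def by blast
  then have "(D - D') \<bullet> D = (D - D') \<bullet> D'" by meson
  then have "(D - D') \<bullet> (D - D') = 0" by (simp add: inner_diff_right)
  then show ?thesis by simp
qed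

lemma GDERIV_convex_conjugate:
  fixes f :: "'a::euclidean_space \<Rightarrow> real"
  assumes f: "strongly_convex1 f" and s: "s \<in> subdifferential f x"
  shows "GDERIV (convex_conjugate f) s :> x"
  unfolding gderiv_def
proof (rule has_derivativeI_sandwich[where e = 1 and H = "\<lambda>t. norm (t - s) / 2"])
  fix t assume "t \<noteq> s"
  obtain y where t: "t \<in> subdifferential f y"
    using strongly_convex1_ex_subgradient_at[OF f s] by blast
  have "norm (convex_conjugate f t - convex_conjugate f s - (t - s) \<bullet> x) \<le> (1/2) * (norm (t - s))\<^sup>2"
    using convex_conjugate_lower[OF s t] convex_conjugate_upper[OF f s t] by simp
  then show "norm (convex_conjugate f t - convex_conjugate f s - (t - s) \<bullet> x) / norm (t - s)
      \<le> norm (t - s) / 2"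
    using \<open>t \<noteq> s\<close> by (simp add: divide_simps power2_eq_square)
next
  have "isCont (\<lambda>t. norm (t - s) / 2) s" by (intro continuous_intros) auto
  then show "((\<lambda>t. norm (t - s) / 2) \<longlongrightarrow> 0) (at s)" by (auto simp: isCont_def)
qed (auto intro: bounded_linear_inner_left)

lemma gradient_convex_conjugate:
  fixes f :: "'a::euclidean_space \<Rightarrow> real"
  assumes "strongly_convex1 f" "s \<in> subdifferential f x"
  shows "gradient (convex_conjugate f) s = x"
  unfolding gradient_def
  by (rule the_equality) (use GDERIV_convex_conjugate[OF assms] GDERIV_unique in blast)+

text \<open>The gradient of the conjugate inverts the subdifferential. For the method this says that the
  dual iterate is a subgradient at the primal one, whatever the dual update was.\<close>

lemma subdifferential_gradient_conjugate:
  fixes f :: "'a::euclidean_space \<Rightarrow> real"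
  assumes f: "strongly_convex1 f" and t: "subdifferential f z \<noteq> {}"
  shows "s \<in> subdifferential f (gradient (convex_conjugate f) s)"
proof -
  obtain x where x: "s \<in> subdifferential f x"
    using t strongly_convex1_ex_subgradient_at[OF f] by blast
  then show ?thesis using gradient_convex_conjugate[OF f x] by simp
qed

lemma convex_conjugate_smooth:
  fixes f :: "'a::euclidean_space \<Rightarrow> real"
  assumes f: "strongly_convex1 f" and t: "subdifferential f z \<noteq> {}"
  shows "convex_conjugate f t \<le> convex_conjugate f s
    + (t - s) \<bullet> gradient (convex_conjugate f) s + (1/2) * (norm (t - s))\<^sup>2"
  using subdifferential_gradient_conjugate[OF assms] by (rule convex_conjugate_upper[OF f])
    (rule subdifferential_gradient_conjugate[OF assms])

lemma norm_gradient_conjugate_diff_le: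
  fixes f :: "'a::euclidean_space \<Rightarrow> real"
  assumes f: "strongly_convex1 f" and "subdifferential f z \<noteq> {}"
  shows "norm (gradient (convex_conjugate f) s - gradient (convex_conjugate f) t) \<le> norm (s - t)"
proof -
  let ?x = "gradient (convex_conjugate f) s" and ?y = "gradient (convex_conjugate f) t"
  \<comment> \<open>adding the two strong convexity inequalities gives strong monotonicity of the subdifferential\<close>
  have "f ?x + s \<bullet> (?y - ?x) + (1/2) * (norm (?y - ?x))\<^sup>2 \<le> f ?y"
    and "f ?y + t \<bullet> (?x - ?y) + (1/2) * (norm (?x - ?y))\<^sup>2 \<le> f ?x"
    using subdifferential_gradient_conjugate[OF assms] strongly_convex1D[OF f] by blast+
  then have "(norm (?x - ?y))\<^sup>2 \<le> (s - t) \<bullet> (?x - ?y)"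
    by (simp add: inner_diff_left inner_diff_right norm_minus_commute)
  also have "\<dots> \<le> norm (s - t) * norm (?x - ?y)" by (rule norm_cauchy_schwarz)
  finally show ?thesis
    by (cases "?x = ?y") (simp_all add: power2_eq_square)
qed

lemma borel_measurable_gradient_conjugate:
  fixes f :: "'a::euclidean_space \<Rightarrow> real"
  assumes "strongly_convex1 f" "subdifferential f z \<noteq> {}"
  shows "gradient (convex_conjugate f) \<in> borel_measurable borel"
proof (rule borel_measurable_continuous_onI)
  have "1-lipschitz_on UNIV (gradient (convex_conjugate f))"
    using norm_gradient_conjugate_diff_le[OF assms] by (auto simp: lipschitz_on_def dist_norm)
  then show "continuous_on UNIV (gradient (convex_conjugate f))"
    by (rule lipschitz_on_continuous_on)
qed

lemma borel_measurable_convex_conjugate: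
  fixes f :: "'a::euclidean_space \<Rightarrow> real"
  assumes f: "strongly_convex1 f" and "subdifferential f z \<noteq> {}"
  shows "convex_conjugate f \<in> borel_measurable borel"
proof (rule borel_measurable_continuous_onI)
  have "isCont (convex_conjugate f) s" for s
    using GDERIV_convex_conjugate[OF f subdifferential_gradient_conjugate[OF assms]]
    unfolding gderiv_def by (rule has_derivative_continuous)
  then show "continuous_on UNIV (convex_conjugate f)"
    by (simp add: continuous_at_imp_continuous_on)
qed

text \<open>For strongly convex \<open>f\<close> a point is determined by each of its subgradients, so the Bregman
  distance to a fixed \<open>z\<close> is a function of the subgradient alone.\<close>

definition dual_bregman :: "('a::real_inner \<Rightarrow> real) \<Rightarrow> 'a \<Rightarrow> 'a \<Rightarrow> real" where
  "dual_bregman f z s = bregman_dist f s (gradient (convex_conjugate f) s) z"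

text \<open>As a function of \<open>s\<close>, the Bregman distance is the conjugate plus an affine function; this
  transfers the smoothness of the conjugate to it.\<close>

lemma dual_bregman_eq:
  fixes f :: "'a::euclidean_space \<Rightarrow> real"
  assumes "strongly_convex1 f" "subdifferential f w \<noteq> {}"
  shows "dual_bregman f z s = f z + convex_conjugate f s - s \<bullet> z"
  using convex_conjugate_eq[OF subdifferential_gradient_conjugate[OF assms, of s]]
  by (simp add: dual_bregman_def bregman_dist_def inner_diff_right)

lemma dual_bregman_ge:
  fixes f :: "'a::euclidean_space \<Rightarrow> real"
  assumes "strongly_convex1 f" "subdifferential f w \<noteq> {}"
  shows "(1/2) * (norm (gradient (convex_conjugate f) s - z))\<^sup>2 \<le> dual_bregman f z s"
  using strongly_convex1D[OF assms(1) subdifferential_gradient_conjugate[OF assms], of s z]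
  by (simp add: dual_bregman_def bregman_dist_def norm_minus_commute)

lemma dual_bregman_step:
  fixes f :: "'a::euclidean_space \<Rightarrow> real"
  assumes "strongly_convex1 f" "subdifferential f w \<noteq> {}"
  shows "dual_bregman f z (s - d) \<le> dual_bregman f z s
    - d \<bullet> (gradient (convex_conjugate f) s - z) + (1/2) * (norm d)\<^sup>2"
  using convex_conjugate_smooth[OF assms, of "s - d" s]
  by (simp add: dual_bregman_eq[OF assms] inner_diff_left inner_diff_right)

section \<open>Row blocks\<close>

lemma block_vec_diff: "block_vec blk i (v - w) = block_vec blk i v - block_vec blk i w"
  by (auto simp: block_vec_def vec_eq_iff)

lemma continuous_on_block_vec: "continuous_on S (block_vec blk i)"
  unfolding block_vec_def
proof (rule continuous_on_vec_lambda)
  fix r show "continuous_on S (\<lambda>v. if blk r = i then v $ r else 0)"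
    by (cases "blk r = i") (auto intro!: continuous_intros)
qed

lemma borel_measurable_block_vec [measurable]: "block_vec blk i \<in> borel_measurable borel"
  by (intro borel_measurable_continuous_onI continuous_on_block_vec)

lemma block_mat_mult: "block_mat blk i A *v v = block_vec blk i (A *v v)"
  by (auto simp: block_mat_def block_vec_def matrix_vector_mult_def vec_eq_iff)

lemma transpose_block_mat_mult:
  "transpose (block_mat blk i A) *v v = transpose A *v block_vec blk i v"
  by (auto simp: block_mat_def block_vec_def transpose_def matrix_vector_mult_def vec_eq_iff
      intro!: sum.cong)

lemma sum_norm_block_vec:
  assumes "range blk = {1..M}"
  shows "(\<Sum>i = 1..M. (norm (block_vec blk i v))\<^sup>2) = (norm v)\<^sup>2"
proof -
  have sq: "(norm w)\<^sup>2 = (\<Sum>r\<in>UNIV. (w $ r)\<^sup>2)" for w :: "real^'m"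
    unfolding power2_norm_eq_inner inner_vec_def by (simp add: power2_eq_square)
  have "blk r \<in> {1..M}" for r using assms by auto
  then have "(\<Sum>i = 1..M. ((block_vec blk i v) $ r)\<^sup>2) = (v $ r)\<^sup>2" for r
    by (simp add: block_vec_def if_distrib[of "\<lambda>a. a\<^sup>2"] cong: if_cong)
  then show ?thesis unfolding sq by (subst sum.swap) simp
qed

lemma norm_mult_le_spectral_norm: "norm (B *v v) \<le> spectral_norm B * norm v"
  unfolding spectral_norm_def by (rule onorm) simp

lemma spectral_norm_nonneg: "0 \<le> spectral_norm B"
  unfolding spectral_norm_def by (rule onorm_pos_le) simp

lemma inner_transpose_mult: "(transpose B *v w) \<bullet> v = w \<bullet> (B *v (v::real^_))"
  using dot_lmul_matrix[of w B v] by simp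

lemma norm_transpose_mult_le_spectral_norm: "norm (transpose B *v w) \<le> spectral_norm B * norm w"
proof -
  let ?u = "transpose B *v w"
  have "(norm ?u)\<^sup>2 = w \<bullet> (B *v ?u)"
    unfolding power2_norm_eq_inner by (rule inner_transpose_mult)
  also have "\<dots> \<le> norm w * norm (B *v ?u)" by (rule norm_cauchy_schwarz)
  also have "\<dots> \<le> norm w * (spectral_norm B * norm ?u)"
    by (intro mult_left_mono norm_mult_le_spectral_norm) simp
  finally have "norm ?u * norm ?u \<le> (spectral_norm B * norm w) * norm ?u"
    by (simp add: power2_eq_square mult_ac)
  then show ?thesis
    using spectral_norm_nonneg[of B] by (cases "norm ?u = 0") auto
qed

lemma norm_mult_le_square_norm:
  assumes "range blk = {1..M}"
  shows "(norm (A *v v))\<^sup>2 \<le> (square_norm blk M A)\<^sup>2 * (norm v)\<^sup>2"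
proof -
  have "(norm (A *v v))\<^sup>2 = (\<Sum>i = 1..M. (norm (block_mat blk i A *v v))\<^sup>2)"
    unfolding block_mat_mult sum_norm_block_vec[OF assms] ..
  also have "\<dots> \<le> (\<Sum>i = 1..M. (spectral_norm (block_mat blk i A) * norm v)\<^sup>2)"
    by (intro sum_mono power_mono norm_mult_le_spectral_norm) simp
  also have "\<dots> = (square_norm blk M A)\<^sup>2 * (norm v)\<^sup>2"
    by (simp add: square_norm_def sum_nonneg power_mult_distrib sum_distrib_right)
  finally show ?thesis .
qed

lemma subspace_range_transpose: "subspace (range_transpose A)"
  unfolding range_transpose_def by (intro subspace_UNIV linear_subspace_image) simp

lemma bregman_kaczmarz_step_range:
  assumes "s \<in> range_transpose A"
  shows "bregman_kaczmarz_step blk A i \<eta> c x s \<in> range_transpose A"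
proof -
  have "transpose (block_mat blk i A) *v w \<in> range_transpose A" for w
    unfolding transpose_block_mat_mult range_transpose_def by (rule rangeI)
  then show ?thesis
    unfolding bregman_kaczmarz_step_def
    using assms subspace_range_transpose subspace_diff subspace_scale by blast
qed

text \<open>One step, for a fixed queried block with residual \<open>r\<close> and noise \<open>\<epsilon>\<close>. Smoothness of the
  conjugate yields the decrease \<^term>\<open>\<eta> * (r \<bullet> (r - \<epsilon>))\<close> and the quadratic error
  \<^term>\<open>\<eta>\<^sup>2/2 * (norm (r - \<epsilon>))\<^sup>2\<close>, both divided by the squared spectral norm of the block; the
  three terms below sort them by their degree in the noise. For a zero block both sides equal the
  old distance because division by zero gives zero.\<close>

lemma dual_bregman_kaczmarz_step:
  fixes f :: "real^'n \<Rightarrow> real" and A :: "real^'n^'m" and s :: "real^'n" and \<epsilon> :: "real^'m"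
    and blk :: "'m \<Rightarrow> nat" and i :: nat
  assumes f: "strongly_convex1 f" "subdifferential f w \<noteq> {}" and z: "A *v z = b"
  defines "x \<equiv> gradient (convex_conjugate f) s"
    and "r \<equiv> block_vec blk i (A *v gradient (convex_conjugate f) s - b)"
    and "L \<equiv> (spectral_norm (block_mat blk i A))\<^sup>2"
  shows "dual_bregman f z (bregman_kaczmarz_step blk A i \<eta> (block_vec blk i b + \<epsilon>) x s)
    \<le> dual_bregman f z s + (- (\<eta> * (2 - \<eta>) / 2) / L * (norm r)\<^sup>2
        + \<eta> * (1 - \<eta>) / L * (r \<bullet> \<epsilon>) + \<eta>\<^sup>2 / 2 / L * (norm \<epsilon>)\<^sup>2)"
proof -
  let ?B = "block_mat blk i A"
  define d where "d = (\<eta> / L) *\<^sub>R (transpose ?B *v (r - \<epsilon>))"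
  have r: "r = ?B *v x - block_vec blk i b" "r = ?B *v (x - z)"
    by (simp_all add: r_def x_def block_mat_mult block_vec_diff matrix_vector_mult_diff_distrib z)
  have step: "bregman_kaczmarz_step blk A i \<eta> (block_vec blk i b + \<epsilon>) x s = s - d"
    unfolding bregman_kaczmarz_step_def d_def L_def r(1) by (simp only: diff_diff_eq)
  have "d \<bullet> (x - z) = \<eta> / L * ((r - \<epsilon>) \<bullet> r)"
    unfolding d_def inner_scaleR_left inner_transpose_mult r(2) ..
  then have lin: "d \<bullet> (x - z) = \<eta> / L * ((norm r)\<^sup>2 - r \<bullet> \<epsilon>)"
    by (simp add: power2_norm_eq_inner inner_diff_left inner_commute[of \<epsilon>])
  have "(norm d)\<^sup>2 = (\<eta> / L)\<^sup>2 * (norm (transpose ?B *v (r - \<epsilon>)))\<^sup>2"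
    unfolding d_def norm_scaleR power_mult_distrib by (simp add: power_divide)
  also have "\<dots> \<le> (\<eta> / L)\<^sup>2 * (spectral_norm ?B * norm (r - \<epsilon>))\<^sup>2"
    by (intro mult_left_mono power_mono norm_transpose_mult_le_spectral_norm) auto
  also have "\<dots> = \<eta>\<^sup>2 / L * (norm (r - \<epsilon>))\<^sup>2"
    unfolding power_mult_distrib L_def[symmetric] by (cases "L = 0") (simp_all add: power2_eq_square)
  also have "\<dots> = \<eta>\<^sup>2 / L * ((norm r)\<^sup>2 - 2 * (r \<bullet> \<epsilon>) + (norm \<epsilon>)\<^sup>2)"
    by (simp add: power2_norm_eq_inner inner_diff_left inner_diff_right inner_commute algebra_simps)
  finally have quad: "(norm d)\<^sup>2 \<le> \<eta>\<^sup>2 / L * ((norm r)\<^sup>2 - 2 * (r \<bullet> \<epsilon>) + (norm \<epsilon>)\<^sup>2)" .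
  have "dual_bregman f z (s - d) \<le> dual_bregman f z s - d \<bullet> (x - z) + (1/2) * (norm d)\<^sup>2"
    unfolding x_def by (rule dual_bregman_step[OF f])
  also have "\<dots> \<le> dual_bregman f z s - \<eta> / L * ((norm r)\<^sup>2 - r \<bullet> \<epsilon>)
      + (1/2) * (\<eta>\<^sup>2 / L * ((norm r)\<^sup>2 - 2 * (r \<bullet> \<epsilon>) + (norm \<epsilon>)\<^sup>2))"
    using quad lin by simp
  also have "\<dots> = dual_bregman f z s + (- (\<eta> * (2 - \<eta>) / 2) / L * (norm r)\<^sup>2
        + \<eta> * (1 - \<eta>) / L * (r \<bullet> \<epsilon>) + \<eta>\<^sup>2 / 2 / L * (norm \<epsilon>)\<^sup>2)"
    by (cases "L = 0") (simp_all add: field_simps power2_eq_square)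
  finally show ?thesis unfolding step .
qed

section \<open>Independence\<close>

text \<open>Independence of the generated \<open>\<sigma>\<close>-algebras, for two random variables whose values may have
  different types: the index of a block is a number, the noise a vector.\<close>

definition (in prob_space) indep_rvs ::
    "'b measure \<Rightarrow> ('a \<Rightarrow> 'b) \<Rightarrow> 'c measure \<Rightarrow> ('a \<Rightarrow> 'c) \<Rightarrow> bool" where
  "indep_rvs S X T Y \<longleftrightarrow> random_variable S X \<and> random_variable T Y \<and>
     indep_set (sets (vimage_algebra (space M) X S)) (sets (vimage_algebra (space M) Y T))"

lemma (in prob_space) indep_rvs_iff_indep_var: "indep_rvs S X T Y \<longleftrightarrow> indep_var S X T Y"
  by (simp add: indep_rvs_def indep_var_eq sets_vimage_algebra)

lemma (in prob_space) indep_rvs_cong: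
  assumes "indep_rvs S X T Y" and "\<And>\<omega>. \<omega> \<in> space M \<Longrightarrow> X \<omega> = X' \<omega>"
  shows "indep_rvs S X' T Y"
proof -
  have "X -` A \<inter> space M = X' -` A \<inter> space M" for A using assms(2) by auto
  moreover have "random_variable S X \<longleftrightarrow> random_variable S X'"
    using assms(2) by (rule measurable_cong)
  ultimately show ?thesis using assms(1) by (simp add: indep_rvs_def sets_vimage_algebra)
qed

lemma sets_vimage_algebra_compose_subset:
  assumes X: "X \<in> measurable M S" and g: "g \<in> measurable S S'"
  shows "sets (vimage_algebra (space M) (\<lambda>\<omega>. g (X \<omega>)) S') \<subseteq> sets (vimage_algebra (space M) X S)"
proof -
  have "X \<in> space M \<rightarrow> space S" using X by (auto dest: measurable_space)
  then have "X \<in> measurable (vimage_algebra (space M) X S) S" by (rule measurable_vimage_algebra1)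
  then have gX: "(\<lambda>\<omega>. g (X \<omega>)) \<in> measurable (vimage_algebra (space M) X S) S'"
    using g by (rule measurable_compose)
  have "(\<lambda>\<omega>. g (X \<omega>)) \<in> space M \<rightarrow> space S'"
    using measurable_compose[OF X g] by (auto dest: measurable_space)
  then show ?thesis
    using measurable_sets[OF gX] by (auto simp: sets_vimage_algebra2)
qed

lemma (in prob_space) indep_rvs_compose:
  assumes XY: "indep_rvs S X T Y" and g: "g \<in> measurable S S'" and h: "h \<in> measurable T T'"
  shows "indep_rvs S' (\<lambda>\<omega>. g (X \<omega>)) T' (\<lambda>\<omega>. h (Y \<omega>))"
proof -
  have X: "random_variable S X" and Y: "random_variable T Y" using XY by (auto simp: indep_rvs_def)
  show ?thesis
    using XY measurable_compose[OF X g] measurable_compose[OF Y h]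
      sets_vimage_algebra_compose_subset[OF X g] sets_vimage_algebra_compose_subset[OF Y h]
    unfolding indep_rvs_def indep_sets2_eq by blast
qed

text \<open>The state of a process that is driven by an independent sequence is a measurable function of
  the past inputs, hence independent of the next one.\<close>

lemma (in prob_space) indep_var_driven_process:
  assumes X: "indep_vars (\<lambda>_. N) X (UNIV :: nat set)"
    and g: "\<And>k. g k \<in> measurable (N' \<Otimes>\<^sub>M N) N'"
    and y0: "y0 \<in> space N'"
    and Y_0: "\<And>\<omega>. \<omega> \<in> space M \<Longrightarrow> Y 0 \<omega> = y0"
    and Y_Suc: "\<And>k \<omega>. \<omega> \<in> space M \<Longrightarrow> Y (Suc k) \<omega> = g k (Y k \<omega>, X k \<omega>)"
  shows "indep_rvs N' (Y k) N (X k)"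
proof -
  \<comment> \<open>\<open>F k\<close> computes the state at time \<open>k\<close> from the inputs before time \<open>k\<close>\<close>
  define F where "F = rec_nat (\<lambda>z. y0) (\<lambda>k F z. g k (F z, z k))"
  have F_0: "F 0 z = y0" and F_Suc: "F (Suc k) z = g k (F k z, z k)" for k z
    by (simp_all add: F_def)
  have F_meas: "F k \<in> measurable (PiM J (\<lambda>_. N)) N'" if "{..<k} \<subseteq> J" for k J
    using that
  proof (induction k)
    case 0
    then show ?case using y0 by (simp add: F_0 cong: measurable_cong)
  next
    case (Suc k)
    then have "{..<k} \<subseteq> J" "k \<in> J" by auto
    then have "(\<lambda>z. (F k z, z k)) \<in> measurable (PiM J (\<lambda>_. N)) (N' \<Otimes>\<^sub>M N)"
      using Suc.IH by (intro measurable_Pair measurable_component_singleton)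
    then have "(\<lambda>z. g k (F k z, z k)) \<in> measurable (PiM J (\<lambda>_. N)) N'"
      using g by (rule measurable_compose)
    then show ?case by (simp add: F_Suc cong: measurable_cong)
  qed
  have Y: "Y k \<omega> = F k (restrict (\<lambda>j. X j \<omega>) J)" if "\<omega> \<in> space M" "{..<k} \<subseteq> J" for k J \<omega>
    using that(2)
  proof (induction k)
    case 0
    then show ?case by (simp add: Y_0 F_0 that(1))
  next
    case (Suc k)
    then have "{..<k} \<subseteq> J" "k \<in> J" by auto
    then show ?case using Suc.IH by (simp add: Y_Suc F_Suc that(1))
  qed
  have "indep_var (PiM {..<k} (\<lambda>_. N)) (\<lambda>\<omega>. restrict (\<lambda>j. X j \<omega>) {..<k})
      (PiM {k} (\<lambda>_. N)) (\<lambda>\<omega>. restrict (\<lambda>j. X j \<omega>) {k})"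
    by (rule indep_var_restrict[OF X]) auto
  then have "indep_rvs N' (\<lambda>\<omega>. F k (restrict (\<lambda>j. X j \<omega>) {..<k}))
      N (\<lambda>\<omega>. (restrict (\<lambda>j. X j \<omega>) {k}) k)"
    unfolding indep_rvs_iff_indep_var[symmetric]
    by (rule indep_rvs_compose) (auto intro!: F_meas measurable_component_singleton)
  then have "indep_rvs N' (\<lambda>\<omega>. F k (restrict (\<lambda>j. X j \<omega>) {..<k})) N (X k)" by simp
  then show ?thesis
    by (rule indep_rvs_cong) (auto intro!: Y[symmetric])
qed

lemma (in prob_space) indep_var_inner:
  fixes U V :: "'a \<Rightarrow> 'b::euclidean_space"
  assumes ind: "indep_var borel U borel V" and int: "integrable M U" "integrable M V"
  shows "integrable M (\<lambda>\<omega>. U \<omega> \<bullet> V \<omega>)"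
    and "expectation (\<lambda>\<omega>. U \<omega> \<bullet> V \<omega>) = expectation U \<bullet> expectation V"
proof -
  have c: "indep_var borel (\<lambda>\<omega>. U \<omega> \<bullet> u) borel (\<lambda>\<omega>. V \<omega> \<bullet> u)" for u
    using indep_rvs_compose[of borel U borel V "\<lambda>v. v \<bullet> u" borel "\<lambda>v. v \<bullet> u" borel] ind
    by (simp add: indep_rvs_iff_indep_var)
  have i: "integrable M (\<lambda>\<omega>. (U \<omega> \<bullet> u) * (V \<omega> \<bullet> u))"
    and e: "expectation (\<lambda>\<omega>. (U \<omega> \<bullet> u) * (V \<omega> \<bullet> u)) = (expectation U \<bullet> u) * (expectation V \<bullet> u)" for u
    using indep_var_integrable[OF c] indep_var_lebesgue_integral[OF c] int by auto
  have UV: "(\<lambda>\<omega>. U \<omega> \<bullet> V \<omega>) = (\<lambda>\<omega>. \<Sum>u\<in>Basis. (U \<omega> \<bullet> u) * (V \<omega> \<bullet> u))"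
    by (rule ext) (rule euclidean_inner)
  show "integrable M (\<lambda>\<omega>. U \<omega> \<bullet> V \<omega>)"
    unfolding UV by (intro Bochner_Integration.integrable_sum i)
  have "expectation (\<lambda>\<omega>. U \<omega> \<bullet> V \<omega>)
      = (\<Sum>u\<in>Basis. (expectation U \<bullet> u) * (expectation V \<bullet> u))"
    unfolding UV by (simp only: Bochner_Integration.integral_sum i e)
  also have "\<dots> = expectation U \<bullet> expectation V" by (rule euclidean_inner[symmetric])
  finally show "expectation (\<lambda>\<omega>. U \<omega> \<bullet> V \<omega>) = expectation U \<bullet> expectation V" .
qed

lemma (in finite_measure) integrable_if_norm_square_integrable:
  fixes U :: "'a \<Rightarrow> 'b::{banach, second_countable_topology}"
  assumes "U \<in> borel_measurable M" "integrable M (\<lambda>\<omega>. (norm (U \<omega>))\<^sup>2)"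
  shows "integrable M U"
proof (rule Bochner_Integration.integrable_bound[of M "\<lambda>\<omega>. 1 + (norm (U \<omega>))\<^sup>2"])
  have "norm u \<le> 1 + (norm u)\<^sup>2" for u :: 'b
    using self_le_power[of "norm u" 2] by (cases "1 \<le> norm u") (auto intro: add_increasing2)
  then show "AE \<omega> in M. norm (U \<omega>) \<le> norm (1 + (norm (U \<omega>))\<^sup>2)" by simp
qed (use assms in auto)

text \<open>A quadratic form in a residual \<open>R\<close> and a centred noise \<open>V\<close>, observed only on the event
  \<^term>\<open>J = i\<close>. The mixed term vanishes in two stages: \<open>V\<close> stays centred when it is restricted to the
  event, by independence of \<open>J\<close> and \<open>V\<close>, and the restricted noise is independent of \<open>R\<close>, which is
  independent of the pair \<^term>\<open>(J, V)\<close>.\<close>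

lemma (in prob_space) expectation_quadratic_on_event:
  fixes R V :: "'a \<Rightarrow> 'b::euclidean_space" and J :: "'a \<Rightarrow> nat"
    and i :: nat and a b c :: real
  assumes RJV: "indep_rvs borel R (count_space UNIV \<Otimes>\<^sub>M borel) (\<lambda>\<omega>. (J \<omega>, V \<omega>))"
    and JV: "indep_rvs (count_space UNIV) J borel V"
    and R: "integrable M (\<lambda>\<omega>. (norm (R \<omega>))\<^sup>2)"
    and V: "integrable M V" "expectation V = 0" "integrable M (\<lambda>\<omega>. (norm (V \<omega>))\<^sup>2)"
  defines "q \<equiv> \<lambda>\<omega>. indicat_real {i} (J \<omega>)
      * (a * (norm (R \<omega>))\<^sup>2 + b * (R \<omega> \<bullet> V \<omega>) + c * (norm (V \<omega>))\<^sup>2)"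
  shows "integrable M q"
    and "expectation q = prob {\<omega> \<in> space M. J \<omega> = i}
      * (a * expectation (\<lambda>\<omega>. (norm (R \<omega>))\<^sup>2) + c * expectation (\<lambda>\<omega>. (norm (V \<omega>))\<^sup>2))"
proof -
  let ?I = "\<lambda>\<omega>. indicat_real {i} (J \<omega>)" and ?p = "prob {\<omega> \<in> space M. J \<omega> = i}"
  have [measurable]: "R \<in> borel_measurable M" "J \<in> measurable M (count_space UNIV)" "V \<in> borel_measurable M"
    using RJV JV by (auto simp: indep_rvs_def)
  have ind_meas [measurable]: "indicat_real {i} \<in> measurable (count_space UNIV) borel" by simp
  have I: "integrable M ?I"
    by (rule integrable_const_bound[where B = 1]) (auto simp: indicator_def)
  have "expectation ?I = expectation (indicat_real {\<omega> \<in> space M. J \<omega> = i})"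
    by (rule Bochner_Integration.integral_cong) (auto simp: indicator_def)
  also have "\<dots> = ?p" by simp
  finally have EI: "expectation ?I = ?p" .
  have prod: "integrable M (\<lambda>\<omega>. ?I \<omega> * Z \<omega>)" "expectation (\<lambda>\<omega>. ?I \<omega> * Z \<omega>) = ?p * expectation Z"
    if "indep_var borel ?I borel Z" "integrable M Z" for Z :: "'a \<Rightarrow> real"
    using indep_var_integrable[OF that(1) I that(2)] indep_var_lebesgue_integral[OF that(1) I that(2)]
    by (simp_all add: EI)

  have "indep_rvs borel (\<lambda>\<omega>. (norm (R \<omega>))\<^sup>2) borel (\<lambda>\<omega>. indicat_real {i} (fst (J \<omega>, V \<omega>)))"
    by (rule indep_rvs_compose[OF RJV, where g = "\<lambda>v. (norm v)\<^sup>2" and h = "\<lambda>p. indicat_real {i} (fst p)"]) auto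
  then have "indep_var borel (\<lambda>\<omega>. (norm (R \<omega>))\<^sup>2) borel ?I"
    by (simp add: indep_rvs_iff_indep_var)
  note RR = indep_var_integrable[OF this R I] indep_var_lebesgue_integral[OF this R I]

  have "indep_rvs borel ?I borel (\<lambda>\<omega>. (norm (V \<omega>))\<^sup>2)"
    by (rule indep_rvs_compose[OF JV, where g = "indicat_real {i}" and h = "\<lambda>v. (norm v)\<^sup>2"]) auto
  then have VV: "integrable M (\<lambda>\<omega>. ?I \<omega> * (norm (V \<omega>))\<^sup>2)"
      "expectation (\<lambda>\<omega>. ?I \<omega> * (norm (V \<omega>))\<^sup>2) = ?p * expectation (\<lambda>\<omega>. (norm (V \<omega>))\<^sup>2)"
    using prod[OF _ V(3)] by (simp_all add: indep_rvs_iff_indep_var)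

  have IV: "integrable M (\<lambda>\<omega>. ?I \<omega> *\<^sub>R V \<omega>)"
    by (rule Bochner_Integration.integrable_bound[OF V(1)]) (auto simp: indicator_def)
  have "expectation (\<lambda>\<omega>. ?I \<omega> *\<^sub>R V \<omega>) \<bullet> u = 0" for u
  proof -
    have "indep_rvs borel ?I borel (\<lambda>\<omega>. V \<omega> \<bullet> u)"
      by (rule indep_rvs_compose[OF JV, where g = "indicat_real {i}" and h = "\<lambda>v. v \<bullet> u"]) auto
    then have "expectation (\<lambda>\<omega>. ?I \<omega> * (V \<omega> \<bullet> u)) = ?p * expectation (\<lambda>\<omega>. V \<omega> \<bullet> u)"
      using V(1) by (intro prod) (simp_all add: indep_rvs_iff_indep_var)
    also have "\<dots> = 0" using V(1,2) by simp
    finally have "expectation (\<lambda>\<omega>. (?I \<omega> *\<^sub>R V \<omega>) \<bullet> u) = 0" by simp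
    then show ?thesis using integral_inner_left[of u M "\<lambda>\<omega>. ?I \<omega> *\<^sub>R V \<omega>"] IV by metis
  qed
  then have EIV: "expectation (\<lambda>\<omega>. ?I \<omega> *\<^sub>R V \<omega>) = 0" by (rule inner_eq_zero_iff[THEN iffD1])
  have "indep_rvs borel R borel (\<lambda>\<omega>. indicat_real {i} (fst (J \<omega>, V \<omega>)) *\<^sub>R snd (J \<omega>, V \<omega>))"
    by (rule indep_rvs_compose[OF RJV, where g = "\<lambda>v. v" and h = "\<lambda>p. indicat_real {i} (fst p) *\<^sub>R snd p"]) auto
  then have "indep_var borel R borel (\<lambda>\<omega>. ?I \<omega> *\<^sub>R V \<omega>)"
    by (simp add: indep_rvs_iff_indep_var)
  moreover have "integrable M R" using R by (rule integrable_if_norm_square_integrable[rotated]) measurable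
  ultimately have RV: "integrable M (\<lambda>\<omega>. ?I \<omega> * (R \<omega> \<bullet> V \<omega>))"
      "expectation (\<lambda>\<omega>. ?I \<omega> * (R \<omega> \<bullet> V \<omega>)) = 0"
    using indep_var_inner[of R "\<lambda>\<omega>. ?I \<omega> *\<^sub>R V \<omega>"] IV EIV by simp_all

  have q: "q = (\<lambda>\<omega>. a * ((norm (R \<omega>))\<^sup>2 * ?I \<omega>) + b * (?I \<omega> * (R \<omega> \<bullet> V \<omega>)) + c * (?I \<omega> * (norm (V \<omega>))\<^sup>2))"
    by (simp add: q_def algebra_simps fun_eq_iff)
  show "integrable M q" unfolding q using RR(1) RV(1) VV(1) by auto
  show "expectation q = ?p * (a * expectation (\<lambda>\<omega>. (norm (R \<omega>))\<^sup>2) + c * expectation (\<lambda>\<omega>. (norm (V \<omega>))\<^sup>2))"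
    unfolding q using RR RV VV by (simp add: EI algebra_simps)
qed

section \<open>The expected decrease of the Bregman distance\<close>

lemma borel_measurable_matrix_vector_mult [measurable]:
  "(\<lambda>v. (B :: real^'n^'m) *v v) \<in> borel_measurable borel"
  by (intro borel_measurable_continuous_onI matrix_vector_mult_linear_continuous_on)

lemma borel_measurable_kaczmarz_update:
  fixes A :: "real^'n^'m" and G :: "real^'n \<Rightarrow> real^'n"
  assumes [measurable]: "G \<in> borel_measurable borel"
  shows "(\<lambda>(s, i, \<epsilon>). bregman_kaczmarz_step blk A i \<eta> (block_vec blk i b + block_vec blk i \<epsilon>) (G s) s)
    \<in> measurable (borel \<Otimes>\<^sub>M (count_space UNIV \<Otimes>\<^sub>M borel)) borel"
proof -
  let ?N = "borel \<Otimes>\<^sub>M (count_space UNIV \<Otimes>\<^sub>M borel) :: ((real^'n) \<times> nat \<times> (real^'m)) measure"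
  define u where "u i p = bregman_kaczmarz_step blk A i \<eta>
    (block_vec blk i b + block_vec blk i (snd (snd p))) (G (fst p)) (fst p)"
    for i and p :: "(real^'n) \<times> nat \<times> (real^'m)"
  have "u i \<in> borel_measurable ?N" for i
    unfolding u_def bregman_kaczmarz_step_def by measurable
  then have "(\<lambda>p. u (fst (snd p)) p) \<in> borel_measurable ?N"
    by (rule measurable_compose_countable) measurable
  then show ?thesis by (simp add: u_def case_prod_beta)
qed

text \<open>For a zero matrix all query probabilities would be \<open>0/0 = 0\<close>, but they add up to one.\<close>

lemma (in prob_space) random_blocks_square_norm_pos:
  assumes "random_blocks_indep_noise M blk N A \<sigma> \<iota> e"
  shows "0 < (square_norm blk N A)\<^sup>2"
proof (rule ccontr)
  assume "\<not> ?thesis"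
  then have S: "(square_norm blk N A)\<^sup>2 = 0" by simp
  let ?E = "\<lambda>i. {\<omega> \<in> space M. \<iota> 0 \<omega> = i}"
  have "random_variable (count_space UNIV \<Otimes>\<^sub>M borel) (\<lambda>\<omega>. (\<iota> 0 \<omega>, e 0 \<omega>))"
    using assms by (auto simp: random_blocks_indep_noise_def indep_vars_def)
  from measurable_compose[OF this measurable_fst]
  have [measurable]: "\<iota> 0 \<in> measurable M (count_space UNIV)" by simp
  have "space M = (\<Union>i\<in>{1..N}. ?E i)"
    using assms by (auto simp: random_blocks_indep_noise_def)
  then have "1 = prob (\<Union>i\<in>{1..N}. ?E i)" using prob_space by simp
  also have "\<dots> \<le> (\<Sum>i\<in>{1..N}. prob (?E i))"
    by (rule finite_measure_subadditive_finite) auto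
  also have "\<dots> = (\<Sum>i\<in>{1..N}. (spectral_norm (block_mat blk i A))\<^sup>2 / (square_norm blk N A)\<^sup>2)"
    using assms unfolding random_blocks_indep_noise_def by (intro sum.cong) auto
  also have "\<dots> = 0" by (simp only: S) simp
  finally show False by simp
qed

text \<open>Querying block \<open>i\<close> with probability proportional to its squared spectral norm cancels the
  normalization of the step. The expected decrease therefore contains the full squared residual,
  which the error bound turns back into the Bregman distance, and the blocks contribute their
  noise levels with equal weights. A zero block has zero residual and is never queried.\<close>

lemma (in prob_space) expected_dual_bregman_step:
  fixes f :: "real^'n \<Rightarrow> real" and A :: "real^'n^'m" and blk :: "'m \<Rightarrow> nat"
    and s s' :: "'a \<Rightarrow> real^'n"
  assumes f: "strongly_convex1 f" "subdifferential f w \<noteq> {}" and z: "A *v z = b"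
    and blk: "range blk = {1..N}"
    and theta: "error_bound_constant f A b z \<theta>"
    and random: "random_blocks_indep_noise M blk N A \<sigma> \<iota> e"
    and indep: "indep_rvs borel s (count_space UNIV \<Otimes>\<^sub>M borel) (\<lambda>\<omega>. (\<iota> k \<omega>, e k \<omega>))"
    and range: "\<And>\<omega>. \<omega> \<in> space M \<Longrightarrow> s \<omega> \<in> range_transpose A"
    and int: "integrable M (\<lambda>\<omega>. dual_bregman f z (s \<omega>))"
    and s'_meas: "s' \<in> borel_measurable M"
    and s': "\<And>\<omega>. \<omega> \<in> space M \<Longrightarrow> s' \<omega> = bregman_kaczmarz_step blk A (\<iota> k \<omega>) \<eta>
        (block_vec blk (\<iota> k \<omega>) b + block_vec blk (\<iota> k \<omega>) (e k \<omega>))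
        (gradient (convex_conjugate f) (s \<omega>)) (s \<omega>)"
    and eta: "0 \<le> \<eta>" "\<eta> \<le> 2"
  shows "integrable M (\<lambda>\<omega>. dual_bregman f z (s' \<omega>))"
    and "expectation (\<lambda>\<omega>. dual_bregman f z (s' \<omega>))
      \<le> (1 - \<eta> * (2 - \<eta>) / 2 * (\<theta> / (square_norm blk N A)\<^sup>2)) * expectation (\<lambda>\<omega>. dual_bregman f z (s \<omega>))
        + \<eta>\<^sup>2 / 2 * ((\<Sum>i = 1..N. (\<sigma> i)\<^sup>2) / (square_norm blk N A)\<^sup>2)"
proof -
  let ?D = "dual_bregman f z" and ?G = "gradient (convex_conjugate f)"
  let ?S = "(square_norm blk N A)\<^sup>2" and ?L = "\<lambda>i. (spectral_norm (block_mat blk i A))\<^sup>2"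
  let ?p = "\<lambda>i. prob {\<omega> \<in> space M. \<iota> k \<omega> = i}"
  define c where "c = \<eta> * (2 - \<eta>) / 2"
  define r where "r \<omega> = A *v ?G (s \<omega>) - b" for \<omega>
  define R where "R i \<omega> = block_vec blk i (r \<omega>)" for i \<omega>
  define W where "W i \<omega> = block_vec blk i (e k \<omega>)" for i \<omega>
  \<comment> \<open>the bound on the change of the distance if block \<open>i\<close> is queried, and zero otherwise\<close>
  define q where "q i \<omega> = indicat_real {i} (\<iota> k \<omega>) * ((- c / ?L i) * (norm (R i \<omega>))\<^sup>2
      + \<eta> * (1 - \<eta>) / ?L i * (R i \<omega> \<bullet> W i \<omega>) + \<eta>\<^sup>2 / 2 / ?L i * (norm (W i \<omega>))\<^sup>2)" for i \<omega>
  have c: "0 \<le> c" using eta by (simp add: c_def)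
  have p: "?p i = ?L i / ?S"
    and W: "integrable M (W i)" "expectation (W i) = 0" "integrable M (\<lambda>\<omega>. (norm (W i \<omega>))\<^sup>2)"
      "expectation (\<lambda>\<omega>. (norm (W i \<omega>))\<^sup>2) = (\<sigma> i)\<^sup>2"
    if "i \<in> {1..N}" for i
    using random that unfolding random_blocks_indep_noise_def W_def by blast+
  have [measurable]: "?G \<in> borel_measurable borel" "convex_conjugate f \<in> borel_measurable borel"
    by (rule borel_measurable_gradient_conjugate[OF f] borel_measurable_convex_conjugate[OF f])+
  have "?D = (\<lambda>t. f z + convex_conjugate f t - t \<bullet> z)"
    by (rule ext) (rule dual_bregman_eq[OF f])
  then have [measurable]: "?D \<in> borel_measurable borel" by simp
  have pair: "random_variable (count_space UNIV \<Otimes>\<^sub>M borel) (\<lambda>\<omega>. (\<iota> k \<omega>, e k \<omega>))"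
    and s_meas [measurable]: "s \<in> borel_measurable M"
    using indep by (auto simp: indep_rvs_def)
  have rvs: "\<iota> k \<in> measurable M (count_space UNIV)" "e k \<in> borel_measurable M"
    using measurable_compose[OF pair measurable_fst] measurable_compose[OF pair measurable_snd]
    by simp_all
  have indep_ie: "indep_rvs (count_space UNIV) (\<iota> k) borel (e k)"
    using random rvs by (auto simp: indep_rvs_def random_blocks_indep_noise_def)
  \<comment> \<open>the residual vanishes at \<open>z\<close>, so strong convexity bounds it by the integrable Bregman distance\<close>
  have r_int: "integrable M (\<lambda>\<omega>. (norm (r \<omega>))\<^sup>2)"
  proof (rule Bochner_Integration.integrable_bound)
    show "integrable M (\<lambda>\<omega>. 2 * ?S * ?D (s \<omega>))" using int by simp
    have "(norm (r \<omega>))\<^sup>2 \<le> 2 * ?S * ?D (s \<omega>)" for \<omega>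
    proof -
      have "(norm (r \<omega>))\<^sup>2 \<le> ?S * (norm (?G (s \<omega>) - z))\<^sup>2"
        using norm_mult_le_square_norm[OF blk, of A "?G (s \<omega>) - z"]
        by (simp add: r_def matrix_vector_mult_diff_distrib z)
      also have "\<dots> \<le> ?S * (2 * ?D (s \<omega>))"
        using dual_bregman_ge[OF f, of "s \<omega>" z] by (intro mult_left_mono) auto
      finally show ?thesis by simp
    qed
    then show "AE \<omega> in M. norm ((norm (r \<omega>))\<^sup>2) \<le> norm (2 * ?S * ?D (s \<omega>))"
      by (intro AE_I2) (simp add: order_trans[OF _ abs_ge_self])
  qed (simp add: r_def)
  have R_int: "integrable M (\<lambda>\<omega>. (norm (R i \<omega>))\<^sup>2)" if i: "i \<in> {1..N}" for i
  proof (rule Bochner_Integration.integrable_bound[OF r_int])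
    have "(norm (R i \<omega>))\<^sup>2 \<le> (norm (r \<omega>))\<^sup>2" for \<omega>
      unfolding R_def sum_norm_block_vec[OF blk, symmetric, of "r \<omega>"]
      by (rule member_le_sum[OF i]) auto
    then show "AE \<omega> in M. norm ((norm (R i \<omega>))\<^sup>2) \<le> norm ((norm (r \<omega>))\<^sup>2)" by simp
  qed (simp add: R_def r_def)

  have q: "integrable M (q i)"
      "expectation (q i) = ?p i * ((- c / ?L i) * expectation (\<lambda>\<omega>. (norm (R i \<omega>))\<^sup>2)
        + \<eta>\<^sup>2 / 2 / ?L i * (\<sigma> i)\<^sup>2)" if i: "i \<in> {1..N}" for i
  proof -
    have "(\<lambda>v. block_vec blk i (A *v ?G v - b)) \<in> borel_measurable borel" by measurable
    from indep_rvs_compose[OF indep this, of "\<lambda>p. (fst p, block_vec blk i (snd p))" "count_space UNIV \<Otimes>\<^sub>M borel"]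
    have RJW: "indep_rvs borel (R i) (count_space UNIV \<Otimes>\<^sub>M borel) (\<lambda>\<omega>. (\<iota> k \<omega>, W i \<omega>))"
      by (simp add: R_def[abs_def] r_def W_def)
    have JW: "indep_rvs (count_space UNIV) (\<iota> k) borel (W i)"
      unfolding W_def by (rule indep_rvs_compose[OF indep_ie]) auto
    note E = expectation_quadratic_on_event[OF RJW JW R_int[OF i] W(1-3)[OF i], of i
        "- c / ?L i" "\<eta> * (1 - \<eta>) / ?L i" "\<eta>\<^sup>2 / 2 / ?L i"]
    show "integrable M (q i)" unfolding q_def by (rule E(1))
    show "expectation (q i) = ?p i * ((- c / ?L i) * expectation (\<lambda>\<omega>. (norm (R i \<omega>))\<^sup>2)
        + \<eta>\<^sup>2 / 2 / ?L i * (\<sigma> i)\<^sup>2)"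
      unfolding q_def using E(2) W(4)[OF i] by simp
  qed
  have q_le: "expectation (q i) \<le> - c / ?S * expectation (\<lambda>\<omega>. (norm (R i \<omega>))\<^sup>2) + \<eta>\<^sup>2 / 2 / ?S * (\<sigma> i)\<^sup>2"
    if i: "i \<in> {1..N}" for i
  proof (cases "?L i = 0")
    case True
    have "R i \<omega> = block_mat blk i A *v (?G (s \<omega>) - z)" for \<omega>
      unfolding R_def r_def block_mat_mult block_vec_diff matrix_vector_mult_diff_distrib z ..
    then have "R i \<omega> = 0" for \<omega>
      using True norm_mult_le_spectral_norm[of "block_mat blk i A" "?G (s \<omega>) - z"] by simp
    then show ?thesis using True by (simp add: q(2)[OF i] p[OF i])
  next
    case False
    then have "?L i / ?S * ((- c / ?L i) * X + \<eta>\<^sup>2 / 2 / ?L i * Y) = - c / ?S * X + \<eta>\<^sup>2 / 2 / ?S * Y"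
      for X Y by (cases "?S = 0") (simp_all add: field_simps)
    then show ?thesis unfolding q(2)[OF i] p[OF i] by (rule eq_refl)
  qed
  define Q where "Q \<omega> = (\<Sum>i = 1..N. q i \<omega>)" for \<omega>
  have Q_int: "integrable M Q" unfolding Q_def by (intro Bochner_Integration.integrable_sum q(1))
  have pointwise: "?D (s' \<omega>) \<le> ?D (s \<omega>) + Q \<omega>" if \<omega>: "\<omega> \<in> space M" for \<omega>
  proof -
    let ?i = "\<iota> k \<omega>"
    have i: "?i \<in> {1..N}"
      using random \<omega> unfolding random_blocks_indep_noise_def by blast
    have "Q \<omega> = (\<Sum>i = 1..N. if i = ?i then q ?i \<omega> else 0)"
      unfolding Q_def by (intro sum.cong) (auto simp: q_def)
    also have "\<dots> = q ?i \<omega>" using i by simp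
    finally show ?thesis
      using dual_bregman_kaczmarz_step[OF f z, of blk ?i \<eta> "W ?i \<omega>" "s \<omega>"]
      by (simp add: s'[OF \<omega>] q_def R_def r_def W_def c_def)
  qed
  have D_nonneg: "0 \<le> ?D t" for t
    using dual_bregman_ge[OF f, of t z] by (rule order_trans[rotated]) simp
  have DQ_int: "integrable M (\<lambda>\<omega>. ?D (s \<omega>) + Q \<omega>)" using int Q_int by simp
  show s'_int: "integrable M (\<lambda>\<omega>. ?D (s' \<omega>))"
  proof (rule Bochner_Integration.integrable_bound[OF DQ_int])
    show "(\<lambda>\<omega>. ?D (s' \<omega>)) \<in> borel_measurable M" using s'_meas by measurable
    show "AE \<omega> in M. norm (?D (s' \<omega>)) \<le> norm (?D (s \<omega>) + Q \<omega>)"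
      by (intro AE_I2) (use pointwise D_nonneg in \<open>simp add: order_trans[OF _ abs_ge_self]\<close>)
  qed
  have residual: "\<theta> * expectation (\<lambda>\<omega>. ?D (s \<omega>)) \<le> expectation (\<lambda>\<omega>. (norm (r \<omega>))\<^sup>2)"
  proof -
    have "\<theta> * ?D (s \<omega>) \<le> (norm (r \<omega>))\<^sup>2" if "\<omega> \<in> space M" for \<omega>
      using theta subdifferential_gradient_conjugate[OF f] range[OF that]
      by (auto simp: error_bound_constant_def dual_bregman_def r_def field_simps)
    then have "expectation (\<lambda>\<omega>. \<theta> * ?D (s \<omega>)) \<le> expectation (\<lambda>\<omega>. (norm (r \<omega>))\<^sup>2)"
      using int r_int by (intro integral_mono) auto
    then show ?thesis by simp
  qed
  have "expectation Q = (\<Sum>i = 1..N. expectation (q i))"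
    unfolding Q_def by (rule Bochner_Integration.integral_sum) (rule q(1))
  also have "\<dots> \<le> (\<Sum>i = 1..N. - c / ?S * expectation (\<lambda>\<omega>. (norm (R i \<omega>))\<^sup>2) + \<eta>\<^sup>2 / 2 / ?S * (\<sigma> i)\<^sup>2)"
    by (rule sum_mono) (rule q_le)
  also have "\<dots> = - c / ?S * (\<Sum>i = 1..N. expectation (\<lambda>\<omega>. (norm (R i \<omega>))\<^sup>2))
      + \<eta>\<^sup>2 / 2 / ?S * (\<Sum>i = 1..N. (\<sigma> i)\<^sup>2)"
    by (simp only: sum.distrib sum_distrib_left)
  also have "(\<Sum>i = 1..N. expectation (\<lambda>\<omega>. (norm (R i \<omega>))\<^sup>2)) = expectation (\<lambda>\<omega>. (norm (r \<omega>))\<^sup>2)"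
    unfolding sum_norm_block_vec[OF blk, symmetric, of "r _"] R_def[symmetric]
    by (rule Bochner_Integration.integral_sum[symmetric]) (rule R_int)
  also have "- c / ?S * expectation (\<lambda>\<omega>. (norm (r \<omega>))\<^sup>2) \<le> - c / ?S * (\<theta> * expectation (\<lambda>\<omega>. ?D (s \<omega>)))"
    using residual c by (intro mult_left_mono_neg) auto
  finally have EQ: "expectation Q \<le> - c / ?S * (\<theta> * expectation (\<lambda>\<omega>. ?D (s \<omega>)))
      + \<eta>\<^sup>2 / 2 / ?S * (\<Sum>i = 1..N. (\<sigma> i)\<^sup>2)" by simp
  have "expectation (\<lambda>\<omega>. ?D (s' \<omega>)) \<le> expectation (\<lambda>\<omega>. ?D (s \<omega>) + Q \<omega>)"
    using s'_int DQ_int pointwise by (intro integral_mono) auto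
  also have "\<dots> = expectation (\<lambda>\<omega>. ?D (s \<omega>)) + expectation Q" using int Q_int by simp
  also have "\<dots> \<le> (1 - c * (\<theta> / ?S)) * expectation (\<lambda>\<omega>. ?D (s \<omega>))
      + \<eta>\<^sup>2 / 2 * ((\<Sum>i = 1..N. (\<sigma> i)\<^sup>2) / ?S)"
    using EQ by (simp add: algebra_simps)
  finally show "expectation (\<lambda>\<omega>. ?D (s' \<omega>))
      \<le> (1 - \<eta> * (2 - \<eta>) / 2 * (\<theta> / ?S)) * expectation (\<lambda>\<omega>. ?D (s \<omega>))
        + \<eta>\<^sup>2 / 2 * ((\<Sum>i = 1..N. (\<sigma> i)\<^sup>2) / ?S)"
    unfolding c_def .
qed

section \<open>The stepsize recursion\<close>

text \<open>The chosen stepsize minimizes the one-step bound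
  \<^term>\<open>(1 - t * (2 - t) / 2 * \<gamma>) * \<beta> + t\<^sup>2 / 2\<close> over \<open>t\<close>; substituting the stationarity condition
  \<^term>\<open>t * (\<gamma> * \<beta> + 1) = \<gamma> * \<beta>\<close> collapses the bound to the closed form.\<close>

lemma stepsize_recursion_closed_form:
  fixes \<beta> \<gamma> \<eta> :: real
  assumes eta: "\<eta> = \<gamma> * \<beta> / (\<gamma> * \<beta> + 1)" and "0 \<le> \<gamma> * \<beta>"
  shows "(1 - \<eta> * (2 - \<eta>) / 2 * \<gamma>) * \<beta> + \<eta>\<^sup>2 / 2 = \<beta> * (1 - \<gamma> * \<eta> / 2)"
proof -
  have opt: "\<eta> * (\<gamma> * \<beta> + 1) = \<gamma> * \<beta>" using assms by simp
  have "(1 - \<eta> * (2 - \<eta>) / 2 * \<gamma>) * \<beta> + \<eta>\<^sup>2 / 2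
      = \<beta> - \<eta> * (\<gamma> * \<beta>) + \<eta> / 2 * (\<eta> * (\<gamma> * \<beta> + 1))"
    by (simp add: power2_eq_square field_simps)
  also have "\<dots> = \<beta> * (1 - \<gamma> * \<eta> / 2)" unfolding opt by (simp add: field_simps)
  finally show ?thesis .
qed

text \<open>Away from \<open>z\<close>, the Bregman distance lies between half the squared distance to \<open>z\<close> and \<open>1/\<theta>\<close>
  times the squared residual, and the residual is at most the matrix norm times that distance;
  hence \<open>\<theta>\<close> cannot be large. This is what keeps the contraction factors nonnegative.\<close>

lemma error_bound_constant_le:
  fixes f :: "real^'n \<Rightarrow> real"
  assumes f: "strongly_convex1 f" and z: "A *v z = b" and blk: "range blk = {1..N}"
    and theta: "error_bound_constant f A b z \<theta>"
    and s: "s \<in> subdifferential f x" "s \<in> range_transpose A" and "x \<noteq> z"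
  shows "\<theta> \<le> 2 * (square_norm blk N A)\<^sup>2"
proof -
  have "0 < \<theta>" and D: "\<theta> * bregman_dist f s x z \<le> (norm (A *v x - b))\<^sup>2"
    using theta s by (auto simp: error_bound_constant_def field_simps)
  have "(1/2) * (norm (x - z))\<^sup>2 \<le> bregman_dist f s x z"
    using strongly_convex1D[OF f s(1), of z] by (simp add: bregman_dist_def norm_minus_commute)
  then have "\<theta> * ((1/2) * (norm (x - z))\<^sup>2) \<le> \<theta> * bregman_dist f s x z"
    using \<open>0 < \<theta>\<close> by (intro mult_left_mono) auto
  also note D
  also have "(norm (A *v x - b))\<^sup>2 \<le> (square_norm blk N A)\<^sup>2 * (norm (x - z))\<^sup>2"
    using norm_mult_le_square_norm[OF blk, of A "x - z"]
    by (simp add: matrix_vector_mult_diff_distrib z)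
  finally have "\<theta> * (norm (x - z))\<^sup>2 \<le> (2 * (square_norm blk N A)\<^sup>2) * (norm (x - z))\<^sup>2" by simp
  then show ?thesis using \<open>x \<noteq> z\<close> by simp
qed

text \<open>If \<^term>\<open>\<beta> 0 = 0\<close>, then all stepsizes vanish and the recursion is constant. Otherwise
  \<^term>\<open>\<gamma> \<le> 2\<close> makes the contraction factors nonnegative: that of the closed form because stepsizes
  are at most one, and the other because \<^term>\<open>t * (2 - t) \<le> (1::real)\<close> for every \<open>t\<close>.\<close>

lemma stepsize_recursion_bounds:
  fixes \<beta> \<eta> :: "nat \<Rightarrow> real"
  assumes gamma: "0 \<le> \<gamma>" "\<beta> 0 \<noteq> 0 \<Longrightarrow> \<gamma> \<le> 2" and beta_0: "0 \<le> \<beta> 0"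
    and eta: "\<And>k. \<eta> k = \<gamma> * \<beta> k / (\<gamma> * \<beta> k + 1)"
    and beta_Suc: "\<And>k. \<beta> (Suc k) = (1 - \<eta> k * (2 - \<eta> k) / 2 * \<gamma>) * \<beta> k + (\<eta> k)\<^sup>2 / 2"
  shows "0 \<le> \<beta> k" and "0 \<le> \<eta> k" and "\<eta> k \<le> 1"
    and "0 \<le> 1 - \<eta> k * (2 - \<eta> k) / 2 * \<gamma>"
    and "\<beta> (Suc k) = \<beta> k * (1 - \<gamma> * \<eta> k / 2)"
proof -
  have eta_bounds: "0 \<le> \<eta> k \<and> \<eta> k \<le> 1" if "0 \<le> \<beta> k" for k
    using mult_nonneg_nonneg[OF gamma(1) that] by (simp add: eta)
  have closed: "\<beta> (Suc k) = \<beta> k * (1 - \<gamma> * \<eta> k / 2)" if "0 \<le> \<beta> k" for k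
    unfolding beta_Suc using that gamma(1) by (intro stepsize_recursion_closed_form eta) simp
  have beta: "0 \<le> \<beta> k \<and> (\<beta> k \<noteq> 0 \<longrightarrow> \<gamma> \<le> 2)" for k
  proof (induction k)
    case 0
    then show ?case using gamma beta_0 by auto
  next
    case (Suc k)
    show ?case
    proof (cases "\<beta> k = 0")
      case False
      then have "\<gamma> * \<eta> k \<le> 2 * 1"
        using Suc eta_bounds[of k] by (intro mult_mono) auto
      then show ?thesis using Suc False closed[of k] by simp
    qed (simp add: closed)
  qed
  then show "0 \<le> \<beta> k" "0 \<le> \<eta> k" "\<eta> k \<le> 1" "\<beta> (Suc k) = \<beta> k * (1 - \<gamma> * \<eta> k / 2)"
    using eta_bounds closed by auto
  show "0 \<le> 1 - \<eta> k * (2 - \<eta> k) / 2 * \<gamma>"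
  proof (cases "\<beta> k = 0")
    case False
    have "0 \<le> (1 - \<eta> k)\<^sup>2" by simp
    then have "\<eta> k * (2 - \<eta> k) \<le> 1" by (simp add: power2_eq_square algebra_simps)
    then have "\<eta> k * (2 - \<eta> k) * \<gamma> \<le> 1 * 2"
      using False beta[of k] gamma(1) by (intro mult_mono) auto
    then show ?thesis by simp
  qed (simp add: eta)
qed

section \<open>The convergence rate\<close>


theorem corollary3p3:
  fixes A :: "real^'n^('m::{finite,linorder})" and b :: "real^('m::{finite,linorder})"
    and blk :: "'m \<Rightarrow> nat" and M :: nat
    and f :: "real^'n \<Rightarrow> real" and xh :: "real^'n"
    and \<theta> \<gamma> :: real
    and P :: "'w measure"
    and \<iota> :: "nat \<Rightarrow> 'w \<Rightarrow> nat" and e :: "nat \<Rightarrow> 'w \<Rightarrow> real^('m::{finite,linorder})"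
    and \<sigma> :: "nat \<Rightarrow> real" and \<sigma>tot :: real
    and x0s x0 :: "real^'n"
    and x xs :: "nat \<Rightarrow> 'w \<Rightarrow> real^'n"
    and \<beta> \<eta> :: "nat \<Rightarrow> real"
  assumes blocks: "consecutive_blocks blk M"
    and f: "strongly_convex1 f"
    and xh: "{z. is_arg_min f (\<lambda>y. A *v y = b) z} = {xh}"
    and growth: "subdiff_linear_growth f"
    and calm: "subdiff_calm_at f xh"
    and regular: "linearly_regular (subdifferential f xh) (range_transpose A)"
    and theta: "error_bound_constant f A b xh \<theta>"
    and P: "prob_space P"
    and random: "random_blocks_indep_noise P blk M A \<sigma> \<iota> e"
    and sigma: "\<sigma>tot = sqrt (\<Sum>i = 1..M. (\<sigma> i)\<^sup>2)" "\<sigma>tot > 0"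
    and x0s: "x0s \<in> range_transpose A"
    and x0: "x0 = gradient (convex_conjugate f) x0s"
    and xs_0: "\<And>\<omega>. \<omega> \<in> space P \<Longrightarrow> xs 0 \<omega> = x0s"
    and xs_Suc: "\<And>k \<omega>. \<omega> \<in> space P \<Longrightarrow>
      xs (Suc k) \<omega> = bregman_kaczmarz_step blk A (\<iota> k \<omega>) (\<eta> k)
        (block_vec blk (\<iota> k \<omega>) b + block_vec blk (\<iota> k \<omega>) (e k \<omega>)) (x k \<omega>) (xs k \<omega>)"
    and x: "\<And>k \<omega>. \<omega> \<in> space P \<Longrightarrow> x k \<omega> = gradient (convex_conjugate f) (xs k \<omega>)"
    and gamma: "\<gamma> = \<theta> / (square_norm blk M A)\<^sup>2"
    and beta_0: "\<beta> 0 = (square_norm blk M A)\<^sup>2 * bregman_dist f x0s x0 xh / \<sigma>tot\<^sup>2"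
    and eta: "\<And>k. \<eta> k = \<gamma> * \<beta> k / (\<gamma> * \<beta> k + 1)"
    and beta_Suc: "\<And>k. \<beta> (Suc k) = (1 - \<eta> k * (2 - \<eta> k) / 2 * \<gamma>) * \<beta> k + (\<eta> k)\<^sup>2 / 2"
  shows "(\<forall>k. \<beta> (Suc k) = \<beta> k * (1 - \<gamma> * \<eta> k / 2)) \<and>
    (\<forall>k. integrable P (\<lambda>\<omega>. (norm (x k \<omega> - xh))\<^sup>2) \<and>
      prob_space.expectation P (\<lambda>\<omega>. (norm (x k \<omega> - xh))\<^sup>2)
        \<le> 2 * (\<sigma>tot\<^sup>2 / (square_norm blk M A)\<^sup>2) * \<beta> k)"
proof -
  interpret prob_space P by (rule P)
  let ?D = "dual_bregman f xh" and ?G = "gradient (convex_conjugate f)"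
  let ?S = "(square_norm blk M A)\<^sup>2" and ?N = "count_space UNIV \<Otimes>\<^sub>M borel"
  have blk: "range blk = {1..M}" using blocks by (simp add: consecutive_blocks_def)
  have z: "A *v xh = b" using xh by (auto simp: is_arg_min_def)
  \<comment> \<open>linear regularity includes that the subdifferential meets the range, which supplies a subgradient\<close>
  have ne: "subdifferential f xh \<noteq> {}" using regular by (auto simp: linearly_regular_def)
  note fw = f ne
  have S: "0 < ?S" by (rule random_blocks_square_norm_pos[OF random])
  have sigma2: "\<sigma>tot\<^sup>2 = (\<Sum>i = 1..M. (\<sigma> i)\<^sup>2)" by (simp add: sigma sum_nonneg)
  have D0: "bregman_dist f x0s x0 xh = ?D x0s" by (simp add: x0 dual_bregman_def)
  have D_nonneg: "0 \<le> ?D t" for t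
    using dual_bregman_ge[OF fw, of t xh] by (rule order_trans[rotated]) simp
  have gamma_nonneg: "0 \<le> \<gamma>" using theta by (simp add: gamma error_bound_constant_def)
  have gamma_le: "\<gamma> \<le> 2" if "\<beta> 0 \<noteq> 0"
  proof -
    have "x0 \<noteq> xh" using that by (auto simp: beta_0 bregman_dist_def)
    then have "\<theta> \<le> 2 * ?S"
      using subdifferential_gradient_conjugate[OF fw] x0s unfolding x0
      by (intro error_bound_constant_le[OF f z blk theta]) auto
    then show ?thesis using S by (simp add: gamma divide_le_eq)
  qed
  have "0 \<le> \<beta> 0" using D_nonneg by (simp add: beta_0 D0)
  then have steps: "0 \<le> \<eta> k" "\<eta> k \<le> 1" "0 \<le> 1 - \<eta> k * (2 - \<eta> k) / 2 * \<gamma>"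
      "\<beta> (Suc k) = \<beta> k * (1 - \<gamma> * \<eta> k / 2)" for k
    using stepsize_recursion_bounds[of \<gamma> \<beta> \<eta>] gamma_nonneg gamma_le eta beta_Suc by blast+

  have indep: "indep_rvs borel (xs k) ?N (\<lambda>\<omega>. (\<iota> k \<omega>, e k \<omega>))" for k
  proof (rule indep_var_driven_process)
    show "indep_vars (\<lambda>_. ?N) (\<lambda>k \<omega>. (\<iota> k \<omega>, e k \<omega>)) UNIV"
      using random by (simp add: random_blocks_indep_noise_def)
    show "xs (Suc k) \<omega> = (\<lambda>(s, i, \<epsilon>). bregman_kaczmarz_step blk A i (\<eta> k)
        (block_vec blk i b + block_vec blk i \<epsilon>) (?G s) s) (xs k \<omega>, \<iota> k \<omega>, e k \<omega>)"
      if "\<omega> \<in> space P" for k \<omega>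
      using xs_Suc[OF that] x[OF that] by simp
  qed (use xs_0 borel_measurable_kaczmarz_update[OF borel_measurable_gradient_conjugate[OF fw]] in auto)
  then have meas: "xs k \<in> borel_measurable P" for k by (simp add: indep_rvs_def)
  have range: "xs k \<omega> \<in> range_transpose A" if "\<omega> \<in> space P" for k \<omega>
    using that by (induction k) (simp_all add: xs_0 x0s xs_Suc bregman_kaczmarz_step_range)
  \<comment> \<open>the recursion for \<open>\<beta>\<close> is the recursion for the expected distance in units of \<^term>\<open>\<sigma>tot\<^sup>2 / ?S\<close>\<close>
  have bound: "integrable P (\<lambda>\<omega>. ?D (xs k \<omega>)) \<and>
      expectation (\<lambda>\<omega>. ?D (xs k \<omega>)) \<le> \<sigma>tot\<^sup>2 / ?S * \<beta> k" for k
  proof (induction k)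
    case 0
    have "integrable P (\<lambda>\<omega>. ?D (xs 0 \<omega>)) \<longleftrightarrow> integrable P (\<lambda>\<omega>. ?D x0s)"
      by (rule Bochner_Integration.integrable_cong) (simp_all add: xs_0)
    moreover have "expectation (\<lambda>\<omega>. ?D (xs 0 \<omega>)) = expectation (\<lambda>\<omega>. ?D x0s)"
      by (rule Bochner_Integration.integral_cong) (simp_all add: xs_0)
    moreover have "\<sigma>tot\<^sup>2 / ?S * \<beta> 0 = ?D x0s" using S sigma(2) by (simp add: beta_0 D0)
    ultimately show ?case by (simp add: prob_space)
  next
    case (Suc k)
    have eta_le: "\<eta> k \<le> 2" using steps(2)[of k] by simp
    have step: "xs (Suc k) \<omega> = bregman_kaczmarz_step blk A (\<iota> k \<omega>) (\<eta> k)
        (block_vec blk (\<iota> k \<omega>) b + block_vec blk (\<iota> k \<omega>) (e k \<omega>)) (?G (xs k \<omega>)) (xs k \<omega>)"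
      if "\<omega> \<in> space P" for \<omega>
      using xs_Suc[OF that] x[OF that] by simp
    have int: "integrable P (\<lambda>\<omega>. ?D (xs k \<omega>))" using Suc by simp
    have int': "integrable P (\<lambda>\<omega>. ?D (xs (Suc k) \<omega>))"
      by (rule expected_dual_bregman_step(1)[OF fw z blk theta random indep range int meas step
            steps(1) eta_le])
    have "expectation (\<lambda>\<omega>. ?D (xs (Suc k) \<omega>))
        \<le> (1 - \<eta> k * (2 - \<eta> k) / 2 * \<gamma>) * expectation (\<lambda>\<omega>. ?D (xs k \<omega>)) + (\<eta> k)\<^sup>2 / 2 * (\<sigma>tot\<^sup>2 / ?S)"
      unfolding gamma sigma2
      by (rule expected_dual_bregman_step(2)[OF fw z blk theta random indep range int meas step
            steps(1) eta_le])
    also have "\<dots> \<le> (1 - \<eta> k * (2 - \<eta> k) / 2 * \<gamma>) * (\<sigma>tot\<^sup>2 / ?S * \<beta> k) + (\<eta> k)\<^sup>2 / 2 * (\<sigma>tot\<^sup>2 / ?S)"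
      using Suc steps(3)[of k] by (intro add_mono mult_left_mono) auto
    also have "\<dots> = \<sigma>tot\<^sup>2 / ?S * \<beta> (Suc k)" unfolding beta_Suc
      by (simp add: algebra_simps add_divide_distrib diff_divide_distrib)
    finally show ?case using int' by simp
  qed

  have "integrable P (\<lambda>\<omega>. (norm (x k \<omega> - xh))\<^sup>2) \<and>
      expectation (\<lambda>\<omega>. (norm (x k \<omega> - xh))\<^sup>2) \<le> 2 * (\<sigma>tot\<^sup>2 / ?S) * \<beta> k" for k
  proof -
    have le: "(norm (x k \<omega> - xh))\<^sup>2 \<le> 2 * ?D (xs k \<omega>)" if "\<omega> \<in> space P" for \<omega>
      using dual_bregman_ge[OF fw, of "xs k \<omega>" xh] by (simp add: x[OF that])
    have D_int: "integrable P (\<lambda>\<omega>. 2 * ?D (xs k \<omega>))" using bound by simp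
    have int: "integrable P (\<lambda>\<omega>. (norm (x k \<omega> - xh))\<^sup>2)"
    proof (rule Bochner_Integration.integrable_bound[OF D_int])
      have "(\<lambda>\<omega>. ?G (xs k \<omega>)) \<in> borel_measurable P"
        using meas borel_measurable_gradient_conjugate[OF fw] by (rule measurable_compose)
      then have "x k \<in> borel_measurable P" by (simp add: x cong: measurable_cong)
      then show "(\<lambda>\<omega>. (norm (x k \<omega> - xh))\<^sup>2) \<in> borel_measurable P" by measurable
    qed (intro AE_I2, use le in \<open>simp add: order_trans[OF _ abs_ge_self]\<close>)
    have "expectation (\<lambda>\<omega>. (norm (x k \<omega> - xh))\<^sup>2) \<le> expectation (\<lambda>\<omega>. 2 * ?D (xs k \<omega>))"
      using int D_int le by (intro integral_mono) auto
    also have "\<dots> \<le> 2 * (\<sigma>tot\<^sup>2 / ?S) * \<beta> k" using bound[of k] by simp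
    finally show ?thesis using int by simp
  qed
  then show ?thesis using steps(4) by blast
qed

end
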